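(* Let $n\geq 3$ and let $EAG_n=\mathrm{Cay}(A_n,T_2)$ be the extended alternating group graph, where $T_2=\{(1,i,j),(1,j,i)\mid 2\leq i<j\leq n\}$. Then the two largest eigenvalues of $EAG_n$ are $\lambda_1(EAG_n)=(n-1)(n-2)$ and $\lambda_2(EAG_n)=n^2-5n+5$.
   Context: $A_n$ is the alternating group on $\{1,\ldots,n\}$; $(i,j,k)$ denotes the 3-cycle $i\mapsto j\mapsto k\mapsto i$. Products of permutations are read left to right: $\sigma\tau$ means first apply $\sigma$, then $\tau$. For a finite group $\Gamma$ with identity $e$ and a subset $T\subseteq\Gamma\setminus\{e\}$ with $T=T^{-1}$, the Cayley graph $\mathrm{Cay}(\Gamma,T)$ is the undirected graph with vertex set $\Gamma$ and edge set $\{\{\gamma,t\gamma\}\mid \gamma\in\Gamma,\ t\in T\}$. The eigenvalues of a graph $G$ on $N$ vertices are those of its adjacency matrix, listed with multiplicity as $\lambda_1(G)\geq\lambda_2(G)\geq\cdots\geq\lambda_N(G)$. *)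

theory Defs
  imports "HOL-Algebra.Sym_Groups" "Jordan_Normal_Form.Char_Poly"
begin

section \<open>Finite undirected graphs and their eigenvalues\<close>

text \<open>A graph is a pair of its vertex set and its edge set; edges are sets of vertices.\<close>

type_synonym 'a graph = "'a set \<times> 'a set set"

definition verts :: "'a graph \<Rightarrow> 'a set" where
  "verts G = fst G"

definition edges :: "'a graph \<Rightarrow> 'a set set" where
  "edges G = snd G"

definition enumerates :: "'a list \<Rightarrow> 'a set \<Rightarrow> bool" where
  "enumerates vs V \<longleftrightarrow> distinct vs \<and> set vs = V"

definition adjacency_matrix :: "'a list \<Rightarrow> 'a graph \<Rightarrow> real mat" where
  "adjacency_matrix vs G =
     mat (length vs) (length vs) (\<lambda>(i, j). if {vs ! i, vs ! j} \<in> edges G then 1 else 0)"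

text \<open>
  The eigenvalues are the roots of the characteristic polynomial, repeated according to their
  multiplicity and listed in descending order.  The adjacency matrix is real symmetric, so no
  eigenvalue is lost by taking the roots in the reals.  The enumeration of the vertices is
  arbitrary; the list does not depend on it, see graph_eigenvalues_eq below.
\<close>

definition graph_eigenvalues :: "'a graph \<Rightarrow> real list" where
  "graph_eigenvalues G =
     rev (sorted_list_of_multiset
       (proots (char_poly (adjacency_matrix (SOME vs. enumerates vs (verts G)) G))))"

text \<open>The eigenvalues are numbered from 1.\<close>

definition graph_eigenvalue :: "nat \<Rightarrow> 'a graph \<Rightarrow> real" where
  "graph_eigenvalue k G = graph_eigenvalues G ! (k - 1)"

lemma adjacency_matrix_similar:
  assumes "enumerates vs V" "enumerates ws V"
  shows "similar_mat (adjacency_matrix vs G) (adjacency_matrix ws G)"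
proof -
  let ?N = "length vs"
  have dv: "distinct vs" and dw: "distinct ws" and sets: "set vs = set ws"
    using assms by (auto simp: enumerates_def)
  have len: "length ws = ?N"
    using distinct_card[OF dv] distinct_card[OF dw] sets by simp
  have "\<forall>i<?N. \<exists>j<?N. ws ! j = vs ! i"
    using sets len by (metis in_set_conv_nth)
  then obtain f where f: "\<And>i. i < ?N \<Longrightarrow> f i < ?N" "\<And>i. i < ?N \<Longrightarrow> ws ! f i = vs ! i"
    by metis
  have "\<forall>i<?N. \<exists>j<?N. vs ! j = ws ! i"
    using sets len by (metis in_set_conv_nth)
  then obtain g where g: "\<And>i. i < ?N \<Longrightarrow> g i < ?N" "\<And>i. i < ?N \<Longrightarrow> vs ! g i = ws ! i"
    by metis
  have fg: "j = f i \<longleftrightarrow> i = g j" if "i < ?N" "j < ?N" for i j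
    using that f[of i] g[of j] dv dw len by (metis nth_eq_iff_index_eq)
  define P :: "real mat" where "P = mat ?N ?N (\<lambda>(i, j). if j = f i then 1 else 0)"
  define Q :: "real mat" where "Q = mat ?N ?N (\<lambda>(i, j). if i = f j then 1 else 0)"
  have dims: "P \<in> carrier_mat ?N ?N" "Q \<in> carrier_mat ?N ?N"
    by (auto simp: P_def Q_def)
  have rowP: "(P * B) $$ (i, j) = B $$ (f i, j)"
    if "i < ?N" "j < ?N" "B \<in> carrier_mat ?N ?N" for B i j
    using that f(1)[of i] by (simp add: P_def scalar_prod_def if_distrib if_distribR cong: if_cong)
  have colQ: "(B * Q) $$ (i, j) = B $$ (i, f j)"
    if "i < ?N" "j < ?N" "B \<in> carrier_mat ?N ?N" for B i j
    using that f(1)[of j] by (simp add: Q_def scalar_prod_def if_distrib if_distribR cong: if_cong)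
  have inj: "f i = f j \<longleftrightarrow> i = j" if "i < ?N" "j < ?N" for i j
    using that f fg by metis
  have PQ: "P * Q = 1\<^sub>m ?N"
  proof (rule eq_matI)
    fix i j assume "i < dim_row (1\<^sub>m ?N :: real mat)" "j < dim_col (1\<^sub>m ?N :: real mat)"
    then show "(P * Q) $$ (i, j) = 1\<^sub>m ?N $$ (i, j)"
      using rowP[of i j Q] dims f(1)[of i] inj[of i j] by (simp add: Q_def)
  qed (use dims in auto)
  have QP: "Q * P = 1\<^sub>m ?N"
    using mat_mult_left_right_inverse[OF dims PQ] .
  have cv: "adjacency_matrix vs G \<in> carrier_mat ?N ?N"
    and cw: "adjacency_matrix ws G \<in> carrier_mat ?N ?N"
    by (auto simp: adjacency_matrix_def len)
  have "adjacency_matrix vs G = P * adjacency_matrix ws G * Q"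
  proof (rule eq_matI)
    fix i j assume "i < dim_row (P * adjacency_matrix ws G * Q)"
      and "j < dim_col (P * adjacency_matrix ws G * Q)"
    then have ij: "i < ?N" "j < ?N" using dims by auto
    have "(P * adjacency_matrix ws G * Q) $$ (i, j) = adjacency_matrix ws G $$ (f i, f j)"
      using colQ[OF ij, of "P * adjacency_matrix ws G"] rowP[of i "f j"] ij f(1) dims cw by simp
    also have "\<dots> = adjacency_matrix vs G $$ (i, j)"
      using ij f by (simp add: adjacency_matrix_def len)
    finally show "adjacency_matrix vs G $$ (i, j) = (P * adjacency_matrix ws G * Q) $$ (i, j)" ..
  qed (use dims cv in auto)
  then show ?thesis
    using dims cv cw PQ QP
    by (intro similar_matI[where n = ?N and P = P and Q = Q]) simp_all
qed

lemma graph_eigenvalues_eq: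
  assumes "enumerates vs (verts G)"
  shows "graph_eigenvalues G =
    rev (sorted_list_of_multiset (proots (char_poly (adjacency_matrix vs G))))"
  unfolding graph_eigenvalues_def
  using char_poly_similar[OF adjacency_matrix_similar[OF someI[of "\<lambda>vs. enumerates vs (verts G)", OF assms] assms]]
  by simp


section \<open>Cayley graphs and the extended alternating group graph\<close>

definition cayley_graph :: "('a, 'b) monoid_scheme \<Rightarrow> 'a set \<Rightarrow> 'a graph" where
  "cayley_graph \<Gamma> T =
     (carrier \<Gamma>, {{\<gamma>, t \<otimes>\<^bsub>\<Gamma>\<^esub> \<gamma>} | \<gamma> t. \<gamma> \<in> carrier \<Gamma> \<and> t \<in> T})"

text \<open>
  The library's \<^const>\<open>alt_group\<close> multiplies by composition, that is, from right to left.
  Here products are read from left to right: the first factor is applied first.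
\<close>

definition alt_group_lr :: "nat \<Rightarrow> (nat \<Rightarrow> nat) monoid" where
  "alt_group_lr n = (alt_group n) \<lparr> mult := (\<lambda>\<sigma> \<tau>. \<tau> \<circ> \<sigma>) \<rparr>"

definition T2 :: "nat \<Rightarrow> (nat \<Rightarrow> nat) set" where
  "T2 n = {cycle_of_list [1, i, j] | i j. 2 \<le> i \<and> i < j \<and> j \<le> n} \<union>
          {cycle_of_list [1, j, i] | i j. 2 \<le> i \<and> i < j \<and> j \<le> n}"

definition EAG :: "nat \<Rightarrow> (nat \<Rightarrow> nat) graph" where
  "EAG n = cayley_graph (alt_group_lr n) (T2 n)"

lemma alt_group_lr_is_group: "group (alt_group_lr n)"
proof -
  interpret A: group "alt_group n" by (rule alt_group_is_group)
  show ?thesis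
  proof (rule groupI)
    fix x assume x: "x \<in> carrier (alt_group_lr n)"
    then show "\<exists>y\<in>carrier (alt_group_lr n). y \<otimes>\<^bsub>alt_group_lr n\<^esub> x = \<one>\<^bsub>alt_group_lr n\<^esub>"
      using A.r_inv[of x] A.inv_closed[of x]
      by (auto simp: alt_group_lr_def alt_group_mult)
  qed (use A.m_closed A.one_closed in
        \<open>auto simp: alt_group_lr_def alt_group_mult alt_group_one o_assoc\<close>)
qed

lemma T2_alt:
  "T2 n = {cycle_of_list [1, i, j] | i j. i \<in> {2..n} \<and> j \<in> {2..n} \<and> i \<noteq> j}"
proof -
  have "(\<exists>i j. t = c i j \<and> 2 \<le> i \<and> i < j \<and> j \<le> n) \<or> (\<exists>i j. t = c j i \<and> 2 \<le> i \<and> i < j \<and> j \<le> n)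
      \<longleftrightarrow> (\<exists>i j. t = c i j \<and> i \<in> {2..n} \<and> j \<in> {2..n} \<and> i \<noteq> j)"
    for t and c :: "nat \<Rightarrow> nat \<Rightarrow> nat \<Rightarrow> nat"
    by (auto simp: neq_iff) (metis less_imp_le less_le_trans le_less_trans)+
  from this[of _ "\<lambda>i j. cycle_of_list [1, i, j]"] show ?thesis
    unfolding T2_def by blast
qed

text \<open>The set \<^term>\<open>T2 n\<close> is an admissible connection set: it avoids the identity and is
  closed under inverses.\<close>

lemma T2_subset: "T2 n \<subseteq> carrier (alt_group_lr n) - {\<one>\<^bsub>alt_group_lr n\<^esub>}"
proof
  fix t assume "t \<in> T2 n"
  then obtain i j where ij: "i \<in> {2..n}" "j \<in> {2..n}" "i \<noteq> j" and t: "t = cycle_of_list [1, i, j]"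
    unfolding T2_alt by blast
  have "t \<in> three_cycles n"
    unfolding t by (rule CollectI, rule exI[of _ "[1, i, j]"]) (use ij in auto)
  then have "t \<in> carrier (alt_group n)"
    using three_cycles_incl by blast
  moreover have "t 1 = i"
    using ij by (auto simp: t transpose_def)
  ultimately show "t \<in> carrier (alt_group_lr n) - {\<one>\<^bsub>alt_group_lr n\<^esub>}"
    using ij by (auto simp: alt_group_lr_def alt_group_one)
qed

lemma T2_inverse: "(\<lambda>t. inv\<^bsub>alt_group_lr n\<^esub> t) ` T2 n = T2 n"
proof -
  interpret L: group "alt_group_lr n" by (rule alt_group_lr_is_group)
  have closed: "inv\<^bsub>alt_group_lr n\<^esub> t \<in> T2 n" if t2: "t \<in> T2 n" for t
  proof -
    obtain i j where ij: "i \<in> {2..n}" "j \<in> {2..n}" "i \<noteq> j" and t: "t = cycle_of_list [1, i, j]"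
      using t2 unfolding T2_alt by blast
    let ?s = "cycle_of_list [1, j, i]"
    have s: "?s \<in> T2 n"
      using ij unfolding T2_alt by blast
    have "?s \<otimes>\<^bsub>alt_group_lr n\<^esub> t = \<one>\<^bsub>alt_group_lr n\<^esub>"
    proof -
      have "(t \<circ> ?s) x = x" for x
        using ij by (simp add: t transpose_def)
      then show ?thesis
        by (simp add: alt_group_lr_def alt_group_one fun_eq_iff del: cycle_of_list.simps)
    qed
    moreover have "t \<in> carrier (alt_group_lr n)" "?s \<in> carrier (alt_group_lr n)"
      using t2 s T2_subset by (metis DiffD1 subsetD)+
    ultimately have "inv\<^bsub>alt_group_lr n\<^esub> t = ?s"
      by (rule L.inv_equality)
    then show ?thesis using s by simp
  qed
  moreover have "t = inv\<^bsub>alt_group_lr n\<^esub> (inv\<^bsub>alt_group_lr n\<^esub> t)" if "t \<in> T2 n" for t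
    using L.inv_inv[of t] that T2_subset by (metis DiffD1 subsetD)
  ultimately show ?thesis by (auto intro: image_eqI)
qed

end

theory Submission
  imports Defs
begin

text \<open>
  Let \<open>J\<close> be right convolution with the star transpositions \<open>(1 i)\<close>. The adjacency operator of the
  extended alternating group graph is \<open>J\<^sup>2 - (n - 1)\<close>, so it suffices that the only eigenvalue of \<open>J\<close>
  above \<open>n - 2\<close> is \<open>n - 1\<close>, with constant eigenfunctions, and that \<open>n - 2\<close> occurs. For the bound,
  split a function of mean zero into its projection \<open>g\<close> onto the sums of functions of a single value
  \<open>p x\<close> and a rest \<open>h\<close> orthogonal to all of these. On \<open>g\<close> the operator is explicit. The rest \<open>h\<close> has
  mean zero on every coset of the stabiliser of a point \<open>d\<close>, so by induction the star transpositions
  avoiding \<open>d\<close> contribute at most \<open>n - 3\<close>, and the remaining one contributes at most \<open>1\<close>.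
\<close>

section \<open>The spectral gap of the star transpositions\<close>

text \<open>The point set \<open>D\<close> and the centre \<open>c\<close> are arbitrary because the
  induction deletes points other than \<open>c\<close>.\<close>

definition star_op :: "'a set \<Rightarrow> 'a \<Rightarrow> (('a \<Rightarrow> 'a) \<Rightarrow> real) \<Rightarrow> ('a \<Rightarrow> 'a) \<Rightarrow> real" where
  "star_op D c F p = (\<Sum>i\<in>D - {c}. F (p \<circ> transpose c i))"

text \<open>The inner products of \<open>F\<close> with the indicators of \<open>p x = k\<close>,
  arranged as a matrix in \<open>x\<close> and \<open>k\<close>.\<close>

definition marginal :: "'a set \<Rightarrow> (('a \<Rightarrow> 'a) \<Rightarrow> real) \<Rightarrow> 'a \<Rightarrow> 'a \<Rightarrow> real" where
  "marginal D F x k = (\<Sum>p | p permutes D. F p * of_bool (p x = k))"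

text \<open>Each transposition is an involution, so reindexing the sum by
  \<open>p \<circ> transpose c i\<close> moves it to the other factor.\<close>

lemma star_op_self_adjoint:
  assumes "c \<in> D"
  shows "(\<Sum>p | p permutes D. star_op D c F p * G p) = (\<Sum>p | p permutes D. F p * star_op D c G p)"
proof -
  have "(\<Sum>p | p permutes D. F (p \<circ> transpose c i) * G p)
      = (\<Sum>p | p permutes D. F p * G (p \<circ> transpose c i))" if "i \<in> D - {c}" for i
    using sum_permutations_compose_right[of "transpose c i" D "\<lambda>p. F p * G (p \<circ> transpose c i)"]
      permutes_swap_id[of c D i] assms that
    by (simp add: o_assoc[symmetric])
  then show ?thesis
    unfolding star_op_def sum_distrib_right sum_distrib_left
    by (subst (1 2) sum.swap) simp
qed

text \<open>Group the permutations by the value \<open>p x\<close>. A function with vanishing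
  marginals is thus orthogonal to every function of a single value.\<close>

lemma sum_weighted_eq_marginal:
  assumes "finite D" "x \<in> D"
  shows "(\<Sum>p | p permutes D. F p * \<psi> (p x)) = (\<Sum>k\<in>D. marginal D F x k * \<psi> k)"
proof -
  have "F p * \<psi> (p x) = (\<Sum>k\<in>D. F p * of_bool (p x = k) * \<psi> k)" if "p permutes D" for p
    using assms permutes_in_image[OF that, of x]
    by (simp add: if_distrib[of "\<lambda>t. t * _"] if_distrib[of "\<lambda>t. _ * t"] of_bool_def cong: if_cong)
  then show ?thesis
    unfolding marginal_def sum_distrib_right by (subst sum.swap) simp
qed

text \<open>A permutation sending \<open>d\<close> to \<open>k\<close> is
  \<open>transpose d k \<circ> q\<close> for exactly one \<open>q\<close> permuting
  \<open>S\<close>, because \<open>q\<close> fixes \<open>d\<close>.\<close>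

lemma marginal_eq_coset_sum:
  assumes "finite S" "d \<notin> S" "k \<in> insert d S"
  shows "marginal (insert d S) F d k = (\<Sum>q | q permutes S. F (transpose d k \<circ> q))"
proof -
  have "of_bool ((transpose d b \<circ> q) d = k) = (of_bool (b = k) :: real)" if "q permutes S" for b q
    using permutes_not_in[OF that assms(2)] by simp
  then have "marginal (insert d S) F d k
      = (\<Sum>b\<in>insert d S. \<Sum>q | q permutes S. F (transpose d b \<circ> q) * of_bool (b = k))"
    unfolding marginal_def sum_over_permutations_insert[OF assms(1,2)]
    by (intro sum.cong refl arg_cong2[of _ _ _ _ "(*)"]) auto
  also have "\<dots> = (\<Sum>b\<in>insert d S. (\<Sum>q | q permutes S. F (transpose d b \<circ> q)) * of_bool (b = k))"
    by (simp add: sum_distrib_right)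
  also have "\<dots> = (\<Sum>q | q permutes S. F (transpose d k \<circ> q))"
    using assms(1,3) by (simp add: of_bool_def if_distrib[of "\<lambda>t. _ * t"] cong: if_cong)
  finally show ?thesis .
qed

lemma card_permutes_point:
  assumes "finite D" "x \<in> D" "k \<in> D"
  shows "(\<Sum>p | p permutes D. of_bool (p x = k)) = (fact (card D - 1) :: real)"
proof -
  obtain S where S: "D = insert x S" "x \<notin> S"
    using assms(2) by (meson Set.set_insert)
  then have "marginal D (\<lambda>_. 1) x k = real (card {q. q permutes S})"
    using assms marginal_eq_coset_sum[of S x k "\<lambda>_. 1"] by simp
  then show ?thesis
    using S assms(1) card_permutations[OF refl, of S] by (simp add: marginal_def)
qed

lemma sum_marginal_row:
  assumes "finite D" "x \<in> D"
  shows "(\<Sum>k\<in>D. marginal D F x k) = (\<Sum>p | p permutes D. F p)"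
  using sum_weighted_eq_marginal[OF assms, of F "\<lambda>_. 1"] by simp

text \<open>A permutation takes the value \<open>k\<close> exactly once. For a function of mean
  zero, all row and column sums of the marginal matrix therefore vanish.\<close>

lemma sum_marginal_column:
  assumes "finite D" "k \<in> D"
  shows "(\<Sum>x\<in>D. marginal D F x k) = (\<Sum>p | p permutes D. F p)"
proof -
  have "(\<Sum>x\<in>D. F p * of_bool (p x = k)) = F p" if "p permutes D" for p
  proof -
    have "(\<Sum>x\<in>D. of_bool (p x = k)) = (\<Sum>x\<in>D. of_bool (x = k) :: real)"
      using sum.permute[OF that, of "\<lambda>x. of_bool (x = k) :: real"] by (simp add: o_def)
    also have "\<dots> = 1"
      using assms by (simp add: of_bool_def)
    finally show ?thesis
      by (simp flip: sum_distrib_left)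
  qed
  then show ?thesis
    unfolding marginal_def by (subst sum.swap) simp
qed

text \<open>
  Up to a scalar, taking marginals inverts the map that sends a matrix with vanishing row and
  column sums to a sum of one-point functions.
\<close>

lemma marginal_sum_one_point:
  assumes D: "finite D" "y \<in> D" "j \<in> D"
    and row: "\<And>x. x \<in> D \<Longrightarrow> (\<Sum>k\<in>D. a x k) = 0"
    and col: "\<And>k. k \<in> D \<Longrightarrow> (\<Sum>x\<in>D. a x k) = 0"
  shows "(real (card D) - 1) * marginal D (\<lambda>p. \<Sum>x\<in>D. a x (p x)) y j
      = real (card D) * fact (card D - 1) * a y j"
proof -
  define C :: real where "C = fact (card D - 1)"
  define U where "U x z = (\<Sum>p | p permutes D. a x (p z) * of_bool (p y = j))" for x z
  have Uy: "U x y = C * a x j" for x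
  proof -
    have "U x y = (\<Sum>p | p permutes D. a x j * of_bool (p y = j))"
      unfolding U_def by (intro sum.cong) auto
    then show ?thesis
      using card_permutes_point[OF D] by (simp add: C_def flip: sum_distrib_left)
  qed
  have off: "(real (card D) - 1) * U x x = - C * a x j" if x: "x \<in> D - {y}" for x
  proof -
    \<comment> \<open>Right composition with \<open>transpose x z\<close> fixes \<open>y\<close> and
      so keeps the condition \<open>p y = j\<close>.\<close>
    have swap: "U x z = U x x" if z: "z \<in> D - {y}" for z
    proof -
      have "transpose x z permutes D"
        using x z by (simp add: permutes_swap_id)
      moreover have "transpose x z y = y"
        using x z by (auto simp: transpose_def)
      ultimately show ?thesis
        using sum_permutations_compose_right[of "transpose x z" D
            "\<lambda>p. a x (p x) * of_bool (p y = j)"]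
        by (simp add: U_def)
    qed
    \<comment> \<open>These equal terms together with \<open>U x y\<close> run over a permuted row
      of \<open>a\<close>, whose sum is zero.\<close>
    have "(real (card D) - 1) * U x x = (\<Sum>z\<in>D - {y}. U x z)"
      using D card_gt_0_iff[of D] by (auto simp: swap Suc_le_eq)
    also have "\<dots> = (\<Sum>z\<in>D. U x z) - U x y"
      using D by (simp add: sum_diff1)
    also have "(\<Sum>z\<in>D. U x z) = (\<Sum>p | p permutes D. (\<Sum>z\<in>D. a x (p z)) * of_bool (p y = j))"
      unfolding U_def sum_distrib_right by (rule sum.swap)
    also have "\<dots> = 0"
    proof (rule sum.neutral, clarify)
      fix p assume "p permutes D"
      from sum.permute[OF this, of "a x"] row x
      show "(\<Sum>z\<in>D. a x (p z)) * of_bool (p y = j) = 0" by (simp add: o_def)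
    qed
    finally show ?thesis by (simp add: Uy)
  qed
  have "marginal D (\<lambda>p. \<Sum>x\<in>D. a x (p x)) y j = (\<Sum>x\<in>D. U x x)"
    unfolding marginal_def U_def sum_distrib_right by (rule sum.swap)
  also have "\<dots> = U y y + (\<Sum>x\<in>D - {y}. U x x)"
    using D by (simp add: sum.remove)
  finally have "(real (card D) - 1) * marginal D (\<lambda>p. \<Sum>x\<in>D. a x (p x)) y j
      = (real (card D) - 1) * (C * a y j) + (\<Sum>x\<in>D - {y}. (real (card D) - 1) * U x x)"
    by (simp add: Uy distrib_left sum_distrib_left)
  also have "(\<Sum>x\<in>D - {y}. (real (card D) - 1) * U x x) = - C * (\<Sum>x\<in>D - {y}. a x j)"
    by (simp add: off sum_negf flip: sum_distrib_left)
  \<comment> \<open>The term at \<open>y\<close> counts \<open>card D - 1\<close> times, and the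
    vanishing column sum turns the others into one more copy, whence the factor
    \<open>card D\<close>.\<close>
  also have "(\<Sum>x\<in>D - {y}. a x j) = - a y j"
    using D col by (simp add: sum_diff1)
  finally show ?thesis
    by (simp add: C_def algebra_simps)
qed

text \<open>Composition with \<open>transpose c i\<close> exchanges the values at \<open>c\<close>
  and \<open>i\<close>, so only two summands change. Summed over \<open>i\<close>, the vanishing
  rows and columns leave a single defect term, a function of \<open>p c\<close> alone.\<close>

lemma star_op_sum_one_point:
  assumes D: "finite D" "c \<in> D" and p: "p permutes D"
    and row: "\<And>x. x \<in> D \<Longrightarrow> (\<Sum>k\<in>D. a x k) = 0"
    and col: "\<And>k. k \<in> D \<Longrightarrow> (\<Sum>x\<in>D. a x k) = 0"
  shows "star_op D c (\<lambda>p. \<Sum>x\<in>D. a x (p x)) p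
      = (real (card D) - 2) * (\<Sum>x\<in>D. a x (p x)) - real (card D) * a c (p c)"
proof -
  define G where "G = (\<Sum>x\<in>D. a x (p x))"
  have "(\<Sum>x\<in>D. a x ((p \<circ> transpose c i) x)) = G - a c (p c) - a i (p i) + a c (p i) + a i (p c)"
    if i: "i \<in> D - {c}" for i
  proof -
    have "(\<Sum>x\<in>D. f x) = f c + f i + (\<Sum>x\<in>D - {c} - {i}. f x)" for f :: "'a \<Rightarrow> real"
      using D i by (simp add: sum.remove)
    note split = this
    have "(\<Sum>x\<in>D - {c} - {i}. a x ((p \<circ> transpose c i) x)) = (\<Sum>x\<in>D - {c} - {i}. a x (p x))"
      by (intro sum.cong) auto
    then show ?thesis
      unfolding G_def split[of "\<lambda>x. a x (p x)"] split[of "\<lambda>x. a x ((p \<circ> transpose c i) x)"] by simp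
  qed
  then have "star_op D c (\<lambda>p. \<Sum>x\<in>D. a x (p x)) p
      = (\<Sum>i\<in>D - {c}. G - a c (p c) - a i (p i) + a c (p i) + a i (p c))"
    unfolding star_op_def by (intro sum.cong) auto
  also have "\<dots> = real (card (D - {c})) * (G - a c (p c)) - (\<Sum>i\<in>D - {c}. a i (p i))
      + (\<Sum>i\<in>D - {c}. a c (p i)) + (\<Sum>i\<in>D - {c}. a i (p c))"
    by (simp add: sum.distrib sum_subtractf)
  also have "(\<Sum>i\<in>D - {c}. a i (p i)) = G - a c (p c)"
    using D by (simp add: sum_diff1 G_def)
  also have "(\<Sum>i\<in>D - {c}. a c (p i)) = - a c (p c)"
    using sum.permute[OF p, of "a c"] row D by (simp add: sum_diff1 o_def)
  also have "(\<Sum>i\<in>D - {c}. a i (p c)) = - a c (p c)"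
    using col[of "p c"] permutes_in_image[OF p, of c] D by (simp add: sum_diff1)
  also have "real (card (D - {c})) = real (card D) - 1"
    using D card_gt_0_iff[of D] by (auto simp: Suc_le_eq)
  finally show ?thesis
    by (simp add: G_def algebra_simps)
qed

section \<open>The bound on the quadratic form\<close>

text \<open>The transposition of \<open>c\<close> and \<open>d\<close> contributes at most the
  squared norm, the remaining ones at most \<open>card S - 2\<close> times it, and
  \<open>card S - 2 + 1 = card D - 2\<close>.\<close>

lemma star_op_quadratic_form_step:
  assumes S: "finite S" "c \<in> S" "d \<notin> S" and D: "D = insert d S"
    and IH: "\<And>F. (\<Sum>p | p permutes S. F p) = 0 \<Longrightarrow>
      (\<Sum>p | p permutes S. F p * star_op S c F p)
      \<le> (real (card S) - 2) * (\<Sum>p | p permutes S. (F p)\<^sup>2)"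
    and marg: "\<And>k. k \<in> D \<Longrightarrow> marginal D h d k = 0"
  shows "(\<Sum>p | p permutes D. h p * star_op D c h p)
      \<le> (real (card D) - 2) * (\<Sum>p | p permutes D. (h p)\<^sup>2)"
proof -
  let ?N = "\<Sum>p | p permutes D. (h p)\<^sup>2"
  define t where "t = transpose c d"
  have t: "t permutes D"
    using S D by (simp add: t_def permutes_swap_id)
  have "D - {c} = insert d (S - {c})" "d \<notin> S - {c}"
    using S D by auto
  then have "star_op D c h p = h (p \<circ> t) + star_op S c h p" for p
    using S by (simp add: star_op_def t_def)
  then have "(\<Sum>p | p permutes D. h p * star_op D c h p)
      = (\<Sum>p | p permutes D. h p * h (p \<circ> t)) + (\<Sum>p | p permutes D. h p * star_op S c h p)"
    by (simp add: distrib_left sum.distrib)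
  moreover have "(\<Sum>p | p permutes D. h p * h (p \<circ> t)) \<le> ?N"
  proof -
    have "(\<Sum>p | p permutes D. h p * h (p \<circ> t)) \<le> (\<Sum>p | p permutes D. ((h p)\<^sup>2 + (h (p \<circ> t))\<^sup>2) / 2)"
    proof (rule sum_mono)
      fix p
      show "h p * h (p \<circ> t) \<le> ((h p)\<^sup>2 + (h (p \<circ> t))\<^sup>2) / 2"
        using sum_squares_bound[of "h p" "h (p \<circ> t)"] by simp
    qed
    also have "\<dots> = ?N"
      using sum_permutations_compose_right[OF t, of "\<lambda>p. (h p)\<^sup>2"]
      by (simp add: sum.distrib flip: sum_divide_distrib)
    finally show ?thesis .
  qed
  moreover have "(\<Sum>p | p permutes D. h p * star_op S c h p) \<le> (real (card S) - 2) * ?N"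
  proof -
    \<comment> \<open>\<open>H b\<close> is \<open>h\<close> on the coset of permutations sending
      \<open>d\<close> to \<open>b\<close>. Right composition with permutations of \<open>S\<close>
      preserves this coset, so the operator for \<open>S\<close> acts on each \<open>H b\<close>
      separately.\<close>
    define H where "H b q = h (transpose d b \<circ> q)" for b q
    have H0: "(\<Sum>q | q permutes S. H b q) = 0" if "b \<in> D" for b
      using marg[OF that] marginal_eq_coset_sum[of S d b h] S D that by (simp add: H_def)
    have "star_op S c h (transpose d b \<circ> q) = star_op S c (H b) q" for b q
      by (simp add: star_op_def H_def o_assoc)
    then have "(\<Sum>p | p permutes D. h p * star_op S c h p)
        = (\<Sum>b\<in>D. \<Sum>q | q permutes S. H b q * star_op S c (H b) q)"
      unfolding D sum_over_permutations_insert[OF S(1,3)] by (simp add: H_def)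
    also have "\<dots> \<le> (\<Sum>b\<in>D. (real (card S) - 2) * (\<Sum>q | q permutes S. (H b q)\<^sup>2))"
      by (intro sum_mono IH H0)
    also have "\<dots> = (real (card S) - 2) * ?N"
      unfolding D sum_over_permutations_insert[OF S(1,3)] by (simp add: H_def sum_distrib_left)
    finally show ?thesis .
  qed
  moreover have "real (card D) = real (card S) + 1"
    using S D by simp
  ultimately show ?thesis
    by (simp add: algebra_simps)
qed

text \<open>Constants have eigenvalue \<open>card D - 1\<close>, so this is a spectral gap of at
  least one. In the splitting \<open>F = h + g\<close> the cross terms vanish, and each of the two
  parts obeys the bound.\<close>

lemma star_op_quadratic_form_le:
  assumes "finite D" "c \<in> D" "(\<Sum>p | p permutes D. F p) = 0"
  shows "(\<Sum>p | p permutes D. F p * star_op D c F p)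
      \<le> (real (card D) - 2) * (\<Sum>p | p permutes D. (F p)\<^sup>2)"
  using assms
proof (induction "card D" arbitrary: D F)
  case 0
  then show ?case by auto
next
  case (Suc m)
  show ?case
  proof (cases "D = {c}")
    \<comment> \<open>The factor on the right is \<open>-1\<close> here, but mean zero forces
      \<open>F id = 0\<close>, so both sides vanish.\<close>
    case True
    then have "{p. p permutes D} = {id}" by auto
    then show ?thesis using Suc.prems True by (simp add: star_op_def)
  next
    case False
    then obtain d where d: "d \<in> D" "d \<noteq> c"
      using Suc.prems by auto
    define S where "S = D - {d}"
    have S: "finite S" "c \<in> S" "d \<notin> S" "D = insert d S"
      using d Suc.prems by (auto simp: S_def)
    then have cardS: "m = card S"
      using Suc.hyps(2) by simp
    let ?n = "real (card D)"
    have n: "?n \<ge> 2"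
      using S cardS Suc.hyps(2) card_gt_0_iff[of S] by (auto simp: Suc_le_eq)
    define M where "M = marginal D F"
    \<comment> \<open>This scalar inverts the constant of \<open>marginal_sum_one_point\<close>, so
      that \<open>g\<close> has the same marginals as \<open>F\<close>.\<close>
    define \<kappa> where "\<kappa> = (?n - 1) / (?n * fact (card D - 1))"
    have \<kappa>: "\<kappa> \<ge> 0" using n by (simp add: \<kappa>_def)
    have row: "(\<Sum>k\<in>D. M x k) = 0" if "x \<in> D" for x
      using sum_marginal_row[of D x F] that Suc.prems by (simp add: M_def)
    have col: "(\<Sum>x\<in>D. M x k) = 0" if "k \<in> D" for k
      using sum_marginal_column[of D k F] that Suc.prems by (simp add: M_def)
    define G where "G p = (\<Sum>x\<in>D. M x (p x))" for p
    define g where "g p = \<kappa> * G p" for p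
    define h where "h p = F p - g p" for p
    have marg_g: "marginal D g y j = M y j" if "y \<in> D" "j \<in> D" for y j
    proof -
      have "marginal D g y j = \<kappa> * marginal D G y j"
        by (simp add: marginal_def g_def sum_distrib_left mult.assoc)
      moreover have "(?n - 1) * marginal D G y j = ?n * fact (card D - 1) * M y j"
        unfolding G_def by (rule marginal_sum_one_point) (use row col that Suc.prems in auto)
      ultimately show ?thesis
        using n by (simp add: \<kappa>_def)
    qed
    have marg_h: "marginal D h y j = 0" if "y \<in> D" "j \<in> D" for y j
      using marg_g[OF that]
      by (simp add: h_def[abs_def] marginal_def M_def left_diff_distrib sum_subtractf)
    have orth: "(\<Sum>p | p permutes D. h p * \<psi> (p x)) = 0" if "x \<in> D" for x \<psi>
      using sum_weighted_eq_marginal[of D x h \<psi>] marg_h that Suc.prems by simp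
    have hg: "(\<Sum>p | p permutes D. h p * g p) = 0"
    proof -
      have "(\<Sum>p | p permutes D. h p * g p)
          = \<kappa> * (\<Sum>x\<in>D. \<Sum>p | p permutes D. h p * M x (p x))"
        unfolding g_def G_def sum_distrib_left by (subst sum.swap) (simp add: mult_ac)
      then show ?thesis by (simp add: orth)
    qed
    have Jg: "star_op D c g p = (?n - 2) * g p - \<kappa> * ?n * M c (p c)" if "p permutes D" for p
    proof -
      have "star_op D c g p = \<kappa> * star_op D c G p"
        by (simp add: star_op_def g_def sum_distrib_left)
      also have "star_op D c G p = (?n - 2) * G p - ?n * M c (p c)"
        unfolding G_def
        by (rule star_op_sum_one_point) (use row col that Suc.prems in auto)
      also have "\<kappa> * ((?n - 2) * G p - ?n * M c (p c)) = (?n - 2) * g p - \<kappa> * ?n * M c (p c)"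
        by (simp add: g_def algebra_simps)
      finally show ?thesis .
    qed
    \<comment> \<open>Both \<open>g\<close> and the defect term in \<open>Jg\<close> are built from
      one-point functions, to which \<open>h\<close> is orthogonal.\<close>
    have hJg: "(\<Sum>p | p permutes D. h p * star_op D c g p) = 0"
    proof -
      have "(\<Sum>p | p permutes D. h p * star_op D c g p)
        = (\<Sum>p | p permutes D. (?n - 2) * (h p * g p) - \<kappa> * ?n * (h p * M c (p c)))"
        by (intro sum.cong) (auto simp: Jg algebra_simps)
      also have "\<dots> = 0"
        using orth[of c "M c"] Suc.prems by (simp add: sum_subtractf hg flip: sum_distrib_left)
      finally show ?thesis .
    qed
    have gJh: "(\<Sum>p | p permutes D. g p * star_op D c h p) = 0"
      using star_op_self_adjoint[of c D g h] hJg Suc.prems by (simp add: mult.commute)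
    have gM: "(\<Sum>p | p permutes D. g p * M c (p c)) = (\<Sum>k\<in>D. (M c k)\<^sup>2)"
      using sum_weighted_eq_marginal[of D c g "M c"] marg_g Suc.prems by (simp add: power2_eq_square)
    have gJg: "(\<Sum>p | p permutes D. g p * star_op D c g p)
        \<le> (?n - 2) * (\<Sum>p | p permutes D. (g p)\<^sup>2)"
    proof -
      have "(\<Sum>p | p permutes D. g p * star_op D c g p)
        = (\<Sum>p | p permutes D. (?n - 2) * (g p)\<^sup>2 - \<kappa> * ?n * (g p * M c (p c)))"
        by (intro sum.cong) (auto simp: Jg algebra_simps power2_eq_square)
      also have "\<dots> = (?n - 2) * (\<Sum>p | p permutes D. (g p)\<^sup>2) - \<kappa> * ?n * (\<Sum>k\<in>D. (M c k)\<^sup>2)"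
        by (simp add: sum_subtractf gM flip: sum_distrib_left)
      finally show ?thesis
        using \<kappa> n by (simp add: sum_nonneg)
    qed
    have hJh: "(\<Sum>p | p permutes D. h p * star_op D c h p)
        \<le> (?n - 2) * (\<Sum>p | p permutes D. (h p)\<^sup>2)"
      by (rule star_op_quadratic_form_step[OF S Suc.hyps(1)[OF cardS S(1,2)]])
        (use marg_h d in auto)
    have F: "F p = h p + g p" for p
      by (simp add: h_def)
    have "star_op D c F p = star_op D c h p + star_op D c g p" for p
      by (simp add: star_op_def F sum.distrib)
    then have "(\<Sum>p | p permutes D. F p * star_op D c F p)
        = (\<Sum>p | p permutes D. h p * star_op D c h p) + (\<Sum>p | p permutes D. g p * star_op D c g p)"
      by (simp add: F algebra_simps sum.distrib hJg gJh)
    also have "\<dots> \<le> (?n - 2) * ((\<Sum>p | p permutes D. (h p)\<^sup>2) + (\<Sum>p | p permutes D. (g p)\<^sup>2))"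
      using hJh gJg by (simp add: distrib_left)
    also have "(\<Sum>p | p permutes D. (h p)\<^sup>2) + (\<Sum>p | p permutes D. (g p)\<^sup>2)
        = (\<Sum>p | p permutes D. (F p)\<^sup>2)"
      using hg by (simp add: F power2_sum sum.distrib mult.assoc flip: sum_distrib_left)
    finally show ?thesis .
  qed
qed

section \<open>Eigenfunctions of the star operator and of its square\<close>

text \<open>Subtracting the mean leaves a mean-zero function with the same eigenvalue, and the bound
  on the quadratic form makes it vanish.\<close>

lemma star_op_eigenfunction_constant:
  assumes D: "finite D" "c \<in> D"
    and eig: "\<And>p. p permutes D \<Longrightarrow> star_op D c F p = s * F p"
    and s: "s > real (card D) - 2"
  shows "\<exists>a. \<forall>p. p permutes D \<longrightarrow> F p = a"
proof -
  define N where "N = real (card {p. p permutes D})"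
  have N: "N > 0"
    using D by (simp add: N_def card_permutations[OF refl])
  define m where "m = (\<Sum>p | p permutes D. F p) / N"
  define F0 where "F0 p = F p - m" for p
  have F0_mean: "(\<Sum>p | p permutes D. F0 p) = 0"
    using N by (simp add: F0_def sum_subtractf m_def N_def)
  have const: "star_op D c (\<lambda>_. b) p = real (card D - 1) * b" for b p
    using D by (simp add: star_op_def)
  have "s * (\<Sum>p | p permutes D. F p) = (\<Sum>p | p permutes D. star_op D c F p * 1)"
    by (simp add: eig sum_distrib_left)
  also have "\<dots> = (\<Sum>p | p permutes D. F p) * real (card D - 1)"
    using star_op_self_adjoint[OF D(2), of F "\<lambda>_. 1"] by (simp add: const sum_distrib_right)
  \<comment> \<open>Either \<open>m = 0\<close> or \<open>s = card D - 1\<close>. In both cases the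
    constant \<open>m\<close> satisfies the eigenvalue equation, hence so does
    \<open>F0\<close>.\<close>
  finally have m: "s * m = real (card D - 1) * m"
    using N by (simp add: m_def field_simps)
  have "star_op D c F0 p = star_op D c F p - star_op D c (\<lambda>_. m) p" for p
    by (simp add: star_op_def F0_def sum_subtractf)
  then have F0_eig: "star_op D c F0 p = s * F0 p" if "p permutes D" for p
    using that m by (auto simp: eig const F0_def right_diff_distrib)
  have "(\<Sum>p | p permutes D. F0 p * star_op D c F0 p) = s * (\<Sum>p | p permutes D. (F0 p)\<^sup>2)"
    unfolding sum_distrib_left by (intro sum.cong) (auto simp: F0_eig power2_eq_square)
  then have "s * (\<Sum>p | p permutes D. (F0 p)\<^sup>2) \<le> (real (card D) - 2) * (\<Sum>p | p permutes D. (F0 p)\<^sup>2)"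
    using star_op_quadratic_form_le[OF D F0_mean] by simp
  then have "(\<Sum>p | p permutes D. (F0 p)\<^sup>2) \<le> 0"
    using s by (meson linorder_not_le mult_le_cancel_right)
  then have "(\<Sum>p | p permutes D. (F0 p)\<^sup>2) = 0"
    by (simp add: sum_nonneg antisym)
  then have "\<forall>p. p permutes D \<longrightarrow> F p = m"
    using D by (simp add: sum_nonneg_eq_0_iff finite_permutations F0_def)
  then show ?thesis ..
qed

text \<open>
  Write the eigenvalue of the squared operator as \<open>s\<^sup>2\<close>. Since the operator exchanges functions on
  even and on odd permutations, \<open>star_op D c f + s f\<close> restricts to \<open>s f\<close> on the even ones, and it is
  an eigenfunction of the operator itself.
\<close>

lemma star_op_square_eigenfunction_constant:
  assumes D: "finite D" "c \<in> D"
    and odd: "\<And>p. p permutes D \<Longrightarrow> \<not> evenperm p \<Longrightarrow> f p = 0"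
    and eig: "\<And>p. p permutes D \<Longrightarrow> evenperm p \<Longrightarrow> star_op D c (star_op D c f) p = \<nu> * f p"
    and \<nu>: "\<nu> > (real (card D) - 2)\<^sup>2"
  shows "\<exists>a. \<forall>p. p permutes D \<and> evenperm p \<longrightarrow> f p = a"
proof -
  define s where "s = sqrt \<nu>"
  have s: "s > real (card D) - 2" "s > 0"
    using \<nu> real_less_rsqrt[OF \<nu>] order.strict_trans1[OF zero_le_power2 \<nu>] by (simp_all add: s_def)
  have s2: "s * s = \<nu>"
    using order.strict_trans1[OF zero_le_power2 \<nu>] by (simp add: s_def)
  have star_odd: "p \<circ> transpose c i permutes D \<and> (evenperm (p \<circ> transpose c i) \<longleftrightarrow> \<not> evenperm p)"
    if "p permutes D" "i \<in> D - {c}" for p i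
  proof -
    have "permutation p"
      using that(1) D(1) permutation_permutes by blast
    then show ?thesis
      using that D
      by (auto simp: evenperm_comp evenperm_swap permutation_swap_id permutes_compose permutes_swap_id)
  qed
  have zero_even: "star_op D c f p = 0" if "p permutes D" "evenperm p" for p
    unfolding star_op_def using that star_odd odd by (intro sum.neutral) blast
  have zero_odd: "star_op D c (star_op D c f) p = 0" if "p permutes D" "\<not> evenperm p" for p
    unfolding star_op_def[of D c "star_op D c f"]
    using that star_odd zero_even by (intro sum.neutral) blast
  define F where "F p = star_op D c f p + s * f p" for p
  have "star_op D c F p = s * F p" if p: "p permutes D" for p
  proof -
    have "star_op D c F p = star_op D c (star_op D c f) p + s * star_op D c f p"
      by (simp add: star_op_def F_def sum.distrib sum_distrib_left)
    \<comment> \<open>The assumption \<open>eig\<close> covers the even permutations only; on the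
      odd ones both sides are zero.\<close>
    moreover have "star_op D c (star_op D c f) p = s * (s * f p)"
      using p by (cases "evenperm p") (simp_all add: eig zero_odd odd s2 flip: mult.assoc)
    ultimately show ?thesis
      by (simp add: F_def distrib_left)
  qed
  from star_op_eigenfunction_constant[OF D this s(1)]
  obtain a where a: "\<And>p. p permutes D \<Longrightarrow> F p = a" by blast
  have "f p = a / s" if "p permutes D" "evenperm p" for p
    using a[of p] zero_even that s(2) by (simp add: F_def field_simps)
  then show ?thesis by blast
qed

text \<open>Equal transpositions cancel and give the multiple of \<open>f\<close>; distinct ones
  compose to three-cycles through \<open>c\<close>.\<close>

lemma star_op_square:
  assumes "finite D" "c \<in> D"
  shows "star_op D c (star_op D c f) p = (real (card D) - 1) * f p
    + (\<Sum>(i, j) | i \<in> D - {c} \<and> j \<in> D - {c} \<and> i \<noteq> j. f (p \<circ> (transpose c j \<circ> transpose c i)))"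
proof -
  let ?B = "D - {c}"
  let ?h = "\<lambda>(i, j). f (p \<circ> (transpose c j \<circ> transpose c i))"
  have B: "finite ?B" using assms by simp
  have "star_op D c (star_op D c f) p = (\<Sum>(j, i)\<in>?B \<times> ?B. ?h (i, j))"
    unfolding star_op_def by (simp add: sum.cartesian_product o_assoc)
  also have "\<dots> = sum ?h (?B \<times> ?B)"
    by (rule sum.reindex_bij_witness[of _ prod.swap prod.swap]) auto
  also have "?B \<times> ?B = (\<lambda>i. (i, i)) ` ?B \<union> {(i, j). i \<in> ?B \<and> j \<in> ?B \<and> i \<noteq> j}"
    by auto
  also have "sum ?h \<dots> = sum ?h ((\<lambda>i. (i, i)) ` ?B) + sum ?h {(i, j). i \<in> ?B \<and> j \<in> ?B \<and> i \<noteq> j}"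
    using B by (intro sum.union_disjoint finite_subset[OF _ finite_cartesian_product[OF B B]]) auto
  also have "sum ?h ((\<lambda>i. (i, i)) ` ?B) = real (card ?B) * f p"
    by (subst sum.reindex) (auto simp: inj_on_def)
  also have "real (card ?B) = real (card D) - 1"
    using assms card_gt_0_iff[of D] by (auto simp: Suc_le_eq)
  finally show ?thesis .
qed

text \<open>Among the star transpositions only the one with \<open>i = z\<close> changes the value
  at \<open>z\<close>, replacing it by \<open>p c\<close>. This term is the same for
  \<open>x\<close> and \<open>y\<close> and cancels in the difference.\<close>

lemma star_op_one_point_difference:
  assumes D: "finite D" "c \<in> D" "x \<in> D - {c}" "y \<in> D - {c}"
  shows "star_op D c (\<lambda>p. \<psi> (p x) - \<psi> (p y)) p = (real (card D) - 2) * (\<psi> (p x) - \<psi> (p y))"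
proof -
  have *: "(\<Sum>i\<in>D - {c}. \<psi> ((p \<circ> transpose c i) z)) = \<psi> (p c) + (real (card D) - 2) * \<psi> (p z)"
    if z: "z \<in> D - {c}" for z
  proof -
    have "(\<Sum>i\<in>D - {c}. \<psi> ((p \<circ> transpose c i) z))
        = \<psi> (p c) + (\<Sum>i\<in>D - {c} - {z}. \<psi> ((p \<circ> transpose c i) z))"
      using D z by (subst sum.remove[of _ z]) simp_all
    also have "(\<Sum>i\<in>D - {c} - {z}. \<psi> ((p \<circ> transpose c i) z)) = (\<Sum>i\<in>D - {c} - {z}. \<psi> (p z))"
      using z by (intro sum.cong) (auto simp: transpose_def)
    also have "\<dots> = (real (card D) - 2) * \<psi> (p z)"
    proof -
      \<comment> \<open>With \<open>2 \<le> card D\<close> the natural-number subtraction in the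
        cardinality agrees with the real one.\<close>
      have "card {c, z} \<le> card D"
        using D z by (intro card_mono) auto
      then have "2 \<le> card D" using z by auto
      then show ?thesis using D z by simp
    qed
    finally show ?thesis .
  qed
  show ?thesis
    unfolding star_op_def sum_subtractf *[OF D(3)] *[OF D(4)] by (simp add: algebra_simps)
qed

section \<open>Simple eigenvalues of symmetric matrices\<close>

text \<open>
  Conjugating by the identity matrix whose first column is replaced by ones splits off the factor
  of the all-ones eigenvector. Symmetry excludes a second root: an eigenvector of the remaining
  block lifts to an eigenvector modulo the all-ones vector, and pairing with the all-ones vector
  shows that it is a genuine one.
\<close>

lemma order_char_poly_of_simple_ones_eigenvalue:
  fixes A :: "real mat"
  assumes A: "A \<in> carrier_mat N N" and N: "N > 0"
    and sym: "\<And>i j. i < N \<Longrightarrow> j < N \<Longrightarrow> A $$ (i, j) = A $$ (j, i)"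
    and row: "\<And>i. i < N \<Longrightarrow> (\<Sum>j<N. A $$ (i, j)) = l"
    and simple: "\<And>v. v \<in> carrier_vec N \<Longrightarrow> A *\<^sub>v v = l \<cdot>\<^sub>v v \<Longrightarrow> \<exists>a. v = vec N (\<lambda>_. a)"
  shows "order l (char_poly A) = 1"
proof -
  obtain m where m: "N = Suc m" using N by (cases N) auto
  \<comment> \<open>\<open>B\<close> is \<open>A\<close> in the basis of the all-ones vector and the
    unit vectors other than the first. These are the columns of \<open>P\<close>, and
    \<open>Q\<close> is its inverse.\<close>
  define A1 where "A1 = mat 1 1 (\<lambda>_. l)"
  define A2 where "A2 = mat 1 m (\<lambda>(i, j). A $$ (0, Suc j))"
  define A3 where "A3 = mat m m (\<lambda>(i, j). A $$ (Suc i, Suc j) - A $$ (0, Suc j))"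
  define B where "B = four_block_mat A1 A2 (0\<^sub>m m 1) A3"
  define P :: "real mat" where "P = mat N N (\<lambda>(i, j). if j = 0 \<or> i = j then 1 else 0)"
  define Q :: "real mat" where "Q = mat N N (\<lambda>(i, j). if i = j then 1 else if j = 0 then - 1 else 0)"
  have dims: "A1 \<in> carrier_mat 1 1" "A2 \<in> carrier_mat 1 m" "A3 \<in> carrier_mat m m"
    "B \<in> carrier_mat N N" "P \<in> carrier_mat N N" "Q \<in> carrier_mat N N"
    by (auto simp: A1_def A2_def A3_def B_def P_def Q_def m)
  have mult: "(X * Y) $$ (i, j) = X $$ (i, 0) * Y $$ (0, j) + (\<Sum>k<m. X $$ (i, Suc k) * Y $$ (Suc k, j))"
    if "X \<in> carrier_mat N N" "Y \<in> carrier_mat N N" "i < N" "j < N" for X Y :: "real mat" and i j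
    using that by (simp add: scalar_prod_def m atLeast0LessThan sum.lessThan_Suc_shift
        del: sum.lessThan_Suc)
  have if_mult: "(\<Sum>k<m. (if i = k then 1 else 0) * f k) = (if i < m then f i else 0)"
    "(\<Sum>k<m. (if k = i then 1 else 0) * f k) = (if i < m then f i else 0)"
    "(\<Sum>k<m. f k * (if k = i then 1 else 0)) = (if i < m then f i else 0)"
    for f :: "nat \<Rightarrow> real" and i
    by (simp_all add: if_distrib[of "\<lambda>t. t * _"] if_distrib[of "\<lambda>t. _ * t"] cong: if_cong)
  have PQ: "P * Q = 1\<^sub>m N"
  proof (rule eq_matI)
    fix i j assume "i < dim_row (1\<^sub>m N :: real mat)" "j < dim_col (1\<^sub>m N :: real mat)"
    then have ij: "i < N" "j < N" by auto
    show "(P * Q) $$ (i, j) = 1\<^sub>m N $$ (i, j)"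
      unfolding mult[OF dims(5,6) ij] using ij
      by (cases i; cases j) (simp_all add: P_def Q_def m if_mult sum_negf)
  qed (use dims in auto)
  have QP: "Q * P = 1\<^sub>m N"
    using mat_mult_left_right_inverse[OF dims(5,6) PQ] .
  have AP: "A * P = P * B"
  proof (rule eq_matI)
    fix i j assume "i < dim_row (P * B)" "j < dim_col (P * B)"
    then have ij: "i < N" "j < N" using dims by auto
    have l: "A $$ (i, 0) + (\<Sum>k<m. A $$ (i, Suc k)) = l"
      using row[OF ij(1)] by (simp add: m sum.lessThan_Suc_shift del: sum.lessThan_Suc)
    show "(A * P) $$ (i, j) = (P * B) $$ (i, j)"
      unfolding mult[OF A dims(5) ij] mult[OF dims(5,4) ij] using ij l
      by (cases i; cases j) (simp_all add: P_def B_def A1_def A2_def A3_def m if_mult)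
  qed (use dims A in auto)
  have "A = A * (P * Q)"
    using A by (simp add: PQ)
  also have "\<dots> = P * B * Q"
    using assoc_mult_mat[OF A dims(5,6)] AP by simp
  finally have "similar_mat A B"
    using A dims PQ QP by (intro similar_matI[where n = N and P = P and Q = Q]) auto
  then have "char_poly A = char_poly A1 * char_poly A3"
    using char_poly_similar char_poly_four_block_zeros_col[OF dims(1-3)] by (metis B_def)
  moreover have "char_poly A1 = [:- l, 1:]"
    by (simp add: char_poly_defs A1_def det_single)
  ultimately have char: "char_poly A = [:- l, 1:] * char_poly A3" by simp
  have "\<not> eigenvalue A3 l"
  proof
    assume "eigenvalue A3 l"
    then obtain w where w: "w \<in> carrier_vec m" "w \<noteq> 0\<^sub>v m" and A3w: "A3 *\<^sub>v w = l \<cdot>\<^sub>v w"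
      using dims by (auto simp: eigenvalue_def eigenvector_def)
    \<comment> \<open>The lift \<open>u\<close> of \<open>w\<close> has first coordinate
      \<open>0\<close>, and \<open>e\<close> is its defect: \<open>A\<close> maps \<open>u\<close>
      to \<open>l\<close> times \<open>u\<close> plus \<open>e\<close> times the all-ones
      vector.\<close>
    define u where "u i = (if i = 0 then 0 else w $ (i - 1))" for i
    define e where "e = (\<Sum>j<N. A $$ (0, j) * u j)"
    have Au: "(\<Sum>j<N. A $$ (i, j) * u j) = l * u i + e" if i: "i < N" for i
    proof (cases i)
      case (Suc k)
      then have k: "k < m" using i m by simp
      have "(A3 *\<^sub>v w) $ k = (\<Sum>j<m. A $$ (Suc k, Suc j) * w $ j) - (\<Sum>j<m. A $$ (0, Suc j) * w $ j)"
        using k w dims by (simp add: A3_def scalar_prod_def atLeast0LessThan left_diff_distrib sum_subtractf)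
      then show ?thesis
        using A3w k w Suc by (simp add: e_def m u_def sum.lessThan_Suc_shift del: sum.lessThan_Suc)
    qed (simp add: e_def u_def)
    \<comment> \<open>By symmetry the columns of \<open>A\<close> also sum to \<open>l\<close>, so
      summing all coordinates leaves \<open>N * e = 0\<close>.\<close>
    have "l * (\<Sum>j<N. u j) = (\<Sum>j<N. (\<Sum>i<N. A $$ (j, i)) * u j)"
      by (simp add: row sum_distrib_left)
    also have "\<dots> = (\<Sum>i<N. \<Sum>j<N. A $$ (i, j) * u j)"
      unfolding sum_distrib_right by (subst sum.swap) (simp add: sym)
    also have "\<dots> = l * (\<Sum>j<N. u j) + real N * e"
      by (simp add: Au sum.distrib sum_distrib_left)
    finally have "e = 0" using N by simp
    have "A *\<^sub>v vec N u = l \<cdot>\<^sub>v vec N u"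
      by (rule eq_vecI) (use A Au \<open>e = 0\<close> in \<open>auto simp: scalar_prod_def atLeast0LessThan\<close>)
    from simple[OF _ this] obtain a where a: "vec N u = vec N (\<lambda>_. a)" by auto
    have const: "u i = a" if "i < N" for i
      using arg_cong[OF a, of "\<lambda>v. v $ i"] that by simp
    have "a = 0"
      using const[of 0] N by (simp add: u_def)
    have "w $ k = 0" if "k < m" for k
      using const[of "Suc k"] \<open>a = 0\<close> that by (simp add: u_def m)
    then have "w = 0\<^sub>v m"
      using w by (intro eq_vecI) auto
    with w show False by simp
  qed
  then have "poly (char_poly A3) l \<noteq> 0"
    using eigenvalue_root_char_poly[OF dims(3)] by simp
  then have "char_poly A3 \<noteq> 0" "order l (char_poly A3) = 0"
    by (auto simp: order_root)
  moreover from this have "[:- l, 1:] * char_poly A3 \<noteq> 0"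
    by (simp only: mult_eq_0_iff) simp
  moreover have "order l [:- l, 1:] = 1"
    using order_power_n_n[of l 1] by simp
  ultimately show ?thesis
    unfolding char by (metis add.right_neutral Polynomial.order_mult)
qed

section \<open>The extended alternating group graph\<close>

text \<open>The elements of \<open>T2 n\<close> are the products of two distinct star
  transpositions, each arising from one ordered pair; the equal pairs in the square account for the
  subtracted term.\<close>

lemma sum_T2:
  assumes "n \<ge> 1"
  shows "(\<Sum>t\<in>T2 n. f (p \<circ> t))
    = star_op {1..n} 1 (star_op {1..n} 1 f) p - (real n - 1) * f p"
proof -
  let ?I = "{(i, j). i \<in> {1..n} - {1} \<and> j \<in> {1..n} - {1} \<and> i \<noteq> j}"
  let ?t = "\<lambda>(i, j). transpose 1 j \<circ> transpose 1 i :: nat \<Rightarrow> nat"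
  have cyc: "cycle_of_list [1, i, j] = ?t (i, j)" if "(i, j) \<in> ?I" for i j
    using that by (auto simp: fun_eq_iff transpose_def)
  have "T2 n = (\<lambda>(i, j). cycle_of_list [1, i, j]) ` ?I"
    unfolding T2_alt by (force simp del: cycle_of_list.simps)
  also have "\<dots> = ?t ` ?I"
    by (rule image_cong) (use cyc in auto)
  finally have T2: "T2 n = ?t ` ?I" .
  \<comment> \<open>The pair is recovered from the product by following \<open>1\<close> for two
    steps, which gives injectivity.\<close>
  have val: "?t (i, j) 1 = i" "?t (i, j) i = j" if "(i, j) \<in> ?I" for i j
    using that by (auto simp: transpose_def)
  have "inj_on ?t ?I"
  proof (rule inj_onI)
    fix x y assume xy: "x \<in> ?I" "y \<in> ?I" "?t x = ?t y"
    obtain i j k l where "x = (i, j)" "y = (k, l)" by fastforce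
    have "i = k"
      using val(1)[of i j] val(1)[of k l] xy by (metis \<open>x = (i, j)\<close> \<open>y = (k, l)\<close>)
    moreover have "j = l"
      using val(2)[of i j] val(2)[of k l] xy \<open>i = k\<close> by (metis \<open>x = (i, j)\<close> \<open>y = (k, l)\<close>)
    ultimately show "x = y" by (simp add: \<open>x = (i, j)\<close> \<open>y = (k, l)\<close>)
  qed
  then have "(\<Sum>t\<in>T2 n. f (p \<circ> t)) = (\<Sum>x\<in>?I. f (p \<circ> ?t x))"
    unfolding T2 by (subst sum.reindex) (simp_all add: o_def)
  then show ?thesis
    using assms by (simp add: star_op_square case_prod_unfold)
qed

lemma verts_EAG: "verts (EAG n) = {p. p permutes {1..n} \<and> evenperm p}"
  by (auto simp: verts_def EAG_def cayley_graph_def alt_group_lr_def alt_group_carrier)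

lemma T2_inverse_exists:
  assumes "t \<in> T2 n"
  shows "\<exists>s\<in>T2 n. t \<circ> s = id"
proof -
  interpret L: group "alt_group_lr n" by (rule alt_group_lr_is_group)
  have "inv\<^bsub>alt_group_lr n\<^esub> t \<in> T2 n"
    using T2_inverse assms by blast
  \<comment> \<open>Read from left to right, this product is the composition of \<open>t\<close>
    after its inverse.\<close>
  moreover have "inv\<^bsub>alt_group_lr n\<^esub> t \<otimes>\<^bsub>alt_group_lr n\<^esub> t = \<one>\<^bsub>alt_group_lr n\<^esub>"
    using T2_subset assms by (intro L.l_inv) blast
  ultimately show ?thesis
    by (auto simp: alt_group_lr_def alt_group_one)
qed

text \<open>Left multiplication by \<open>t\<close> is right composition in the left-to-right
  reading. Edges are unordered, so the opposite orientation is handled by an inverse in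
  \<open>T2 n\<close>.\<close>

lemma edges_EAG_iff:
  assumes "p \<in> verts (EAG n)" "q \<in> verts (EAG n)"
  shows "{p, q} \<in> edges (EAG n) \<longleftrightarrow> (\<exists>t\<in>T2 n. q = p \<circ> t)"
proof
  assume "{p, q} \<in> edges (EAG n)"
  then obtain r t where r: "t \<in> T2 n" "{p, q} = {r, r \<circ> t}"
    by (auto simp: edges_def EAG_def cayley_graph_def alt_group_lr_def)
  then consider "p = r" "q = r \<circ> t" | "q = r" "p = r \<circ> t"
    by (auto simp: doubleton_eq_iff)
  then show "\<exists>t\<in>T2 n. q = p \<circ> t"
  proof cases
    case 2
    from T2_inverse_exists[OF r(1)] obtain s where "s \<in> T2 n" "t \<circ> s = id" by blast
    with 2 show ?thesis
      by (metis comp_assoc comp_id)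
  qed (use r in blast)
next
  assume "\<exists>t\<in>T2 n. q = p \<circ> t"
  then show "{p, q} \<in> edges (EAG n)"
    using assms(1) by (auto simp: edges_def verts_def EAG_def cayley_graph_def alt_group_lr_def)
qed

lemma T2_closed:
  assumes "p \<in> verts (EAG n)" "t \<in> T2 n"
  shows "p \<circ> t \<in> verts (EAG n)"
proof -
  interpret L: group "alt_group_lr n" by (rule alt_group_lr_is_group)
  have "t \<otimes>\<^bsub>alt_group_lr n\<^esub> p \<in> carrier (alt_group_lr n)"
    using assms T2_subset by (intro L.m_closed) (auto simp: verts_def EAG_def cayley_graph_def)
  then show ?thesis
    by (simp add: verts_def EAG_def cayley_graph_def alt_group_lr_def)
qed

text \<open>The neighbours of a vertex \<open>p\<close> are the \<open>p \<circ> t\<close>, pairwise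
  distinct because \<open>p\<close> is injective.\<close>

lemma adjacency_matrix_EAG_sum:
  assumes vs: "enumerates vs (verts (EAG n))" and i: "i < length vs"
  shows "(\<Sum>j<length vs. adjacency_matrix vs (EAG n) $$ (i, j) * f (vs ! j))
    = (\<Sum>t\<in>T2 n. f (vs ! i \<circ> t))"
proof -
  let ?V = "verts (EAG n)" and ?p = "vs ! i"
  have vs': "distinct vs" "set vs = ?V" using vs by (auto simp: enumerates_def)
  have p: "?p \<in> ?V" using nth_mem[OF i] vs'(2) by simp
  have fin: "finite ?V" using vs'(2) finite_set by metis
  have bij: "bij_betw ((!) vs) {..<length vs} ?V"
    using bij_betw_nth[OF vs'(1) refl refl] vs'(2) by simp
  have "(\<Sum>j<length vs. adjacency_matrix vs (EAG n) $$ (i, j) * f (vs ! j))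
      = (\<Sum>j<length vs. if {?p, vs ! j} \<in> edges (EAG n) then f (vs ! j) else 0)"
    using i by (intro sum.cong refl) (simp add: adjacency_matrix_def)
  also have "\<dots> = (\<Sum>q\<in>?V. if {?p, q} \<in> edges (EAG n) then f q else 0)"
    by (rule sum.reindex_bij_betw[OF bij])
  also have "\<dots> = (\<Sum>q\<in>{q \<in> ?V. {?p, q} \<in> edges (EAG n)}. f q)"
    by (rule sum.inter_filter[OF fin, symmetric])
  also have "{q \<in> ?V. {?p, q} \<in> edges (EAG n)} = (\<lambda>t. ?p \<circ> t) ` T2 n"
    using edges_EAG_iff[OF p] T2_closed[OF p] by auto
  also have "inj_on (\<lambda>t. ?p \<circ> t) (T2 n)"
    using p inj_on_subset[OF fun.inj_map[OF permutes_inj[of ?p "{1..n}"]], of "T2 n"]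
    by (simp add: verts_EAG)
  then have "sum f ((\<lambda>t. ?p \<circ> t) ` T2 n) = (\<Sum>t\<in>T2 n. f (?p \<circ> t))"
    by (simp add: sum.reindex)
  finally show ?thesis .
qed

lemma adjacency_matrix_EAG_mult_vec:
  assumes "enumerates vs (verts (EAG n))"
  shows "adjacency_matrix vs (EAG n) *\<^sub>v vec (length vs) (\<lambda>i. f (vs ! i))
    = vec (length vs) (\<lambda>i. \<Sum>t\<in>T2 n. f (vs ! i \<circ> t))"
proof (rule eq_vecI)
  let ?A = "adjacency_matrix vs (EAG n)" and ?v = "vec (length vs) (\<lambda>i. f (vs ! i))"
  have A: "?A \<in> carrier_mat (length vs) (length vs)"
    by (simp add: adjacency_matrix_def)
  fix i assume "i < dim_vec (vec (length vs) (\<lambda>i. \<Sum>t\<in>T2 n. f (vs ! i \<circ> t)))"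
  then have i: "i < length vs" by simp
  have "(?A *\<^sub>v ?v) $ i = (\<Sum>j<length vs. ?A $$ (i, j) * f (vs ! j))"
    using A i by (simp add: scalar_prod_def atLeast0LessThan)
  then show "(?A *\<^sub>v ?v) $ i = vec (length vs) (\<lambda>i. \<Sum>t\<in>T2 n. f (vs ! i \<circ> t)) $ i"
    using adjacency_matrix_EAG_sum[OF assms i, of f] i by simp
qed (simp add: adjacency_matrix_def)

section \<open>The two largest eigenvalues of the graph\<close>

text \<open>An eigenvalue \<open>\<mu>\<close> of the graph corresponds to
  \<open>\<mu> + n - 1\<close> for the squared star operator, and the threshold is
  \<open>(n - 2)\<^sup>2 - (n - 1)\<close>.\<close>

lemma EAG_large_eigenvalue:
  assumes n: "n \<ge> 3" and vs: "enumerates vs (verts (EAG n))"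
    and v: "v \<in> carrier_vec (length vs)" "adjacency_matrix vs (EAG n) *\<^sub>v v = \<mu> \<cdot>\<^sub>v v"
    and \<mu>: "\<mu> > (real n)\<^sup>2 - 5 * real n + 5"
  shows "\<exists>a. v = vec (length vs) (\<lambda>_. a)"
proof -
  have vs': "distinct vs" "set vs = verts (EAG n)" using vs by (auto simp: enumerates_def)
  \<comment> \<open>Extension by zero makes \<open>f\<close> vanish on odd permutations, as the
    result on the squared operator demands.\<close>
  define f where "f p = (if p \<in> set vs then v $ (THE i. i < length vs \<and> vs ! i = p) else 0)" for p
  have f: "f (vs ! i) = v $ i" if "i < length vs" for i
  proof -
    have "(THE j. j < length vs \<and> vs ! j = vs ! i) = i"
      using that vs' by (auto simp: nth_eq_iff_index_eq)
    then show ?thesis using that by (simp add: f_def)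
  qed
  have v_eq: "v = vec (length vs) (\<lambda>i. f (vs ! i))"
    using v(1) f by (intro eq_vecI) auto
  have sum_eq: "(\<Sum>t\<in>T2 n. f (p \<circ> t)) = \<mu> * f p" if "p \<in> verts (EAG n)" for p
  proof -
    have "p \<in> set vs" using that vs'(2) by simp
    then obtain i where i: "i < length vs" "vs ! i = p"
      unfolding in_set_conv_nth by blast
    have "adjacency_matrix vs (EAG n) *\<^sub>v v = vec (length vs) (\<lambda>i. \<Sum>t\<in>T2 n. f (vs ! i \<circ> t))"
      using adjacency_matrix_EAG_mult_vec[OF vs, of f] unfolding v_eq[symmetric] .
    then have "(\<mu> \<cdot>\<^sub>v v) $ i = (\<Sum>t\<in>T2 n. f (vs ! i \<circ> t))"
      unfolding v(2) using i(1) by simp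
    then show ?thesis
      using v(1) i(1) f[OF i(1)] unfolding i(2) by simp
  qed
  have "star_op {1..n} 1 (star_op {1..n} 1 f) p = (\<mu> + real n - 1) * f p"
    if "p permutes {1..n}" "evenperm p" for p
    using sum_eq[of p] sum_T2[of n f p] that n by (simp add: verts_EAG algebra_simps)
  moreover have "\<mu> + real n - 1 > (real (card {1..n}) - 2)\<^sup>2"
    using \<mu> by (simp add: power2_eq_square algebra_simps)
  moreover have "f p = 0" if "\<not> evenperm p" for p
    using that vs' by (simp add: f_def verts_EAG)
  ultimately obtain a where "\<And>p. p permutes {1..n} \<Longrightarrow> evenperm p \<Longrightarrow> f p = a"
    using star_op_square_eigenfunction_constant[of "{1..n}" 1 f "\<mu> + real n - 1"] n by auto
  then have "f (vs ! i) = a" if "i < length vs" for i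
    using vs' nth_mem[OF that] by (auto simp: verts_EAG)
  then have "v = vec (length vs) (\<lambda>_. a)"
    using f v(1) by (intro eq_vecI) auto
  then show ?thesis ..
qed

text \<open>For the constant \<open>1\<close> the convolution formula reads
  \<open>(n - 1)\<^sup>2 - (n - 1)\<close>.\<close>

lemma card_T2:
  assumes "n \<ge> 1"
  shows "real (card (T2 n)) = (real n - 1) * (real n - 2)"
  using sum_T2[OF assms, of "\<lambda>_. 1" id] assms
  by (simp add: star_op_def algebra_simps)

lemma EAG_second_eigenvalue:
  assumes n: "n \<ge> 3" and vs: "enumerates vs (verts (EAG n))"
  shows "eigenvalue (adjacency_matrix vs (EAG n)) ((real n)\<^sup>2 - 5 * real n + 5)"
proof -
  \<comment> \<open>The points \<open>2\<close> and \<open>3\<close> differ from the centre and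
    exist because \<open>n \<ge> 3\<close>. The value at \<open>id\<close> is \<open>1\<close>, so
    \<open>f\<close> is nonzero on the vertices.\<close>
  define f :: "(nat \<Rightarrow> nat) \<Rightarrow> real" where "f p = of_bool (p 2 = 2) - of_bool (p 3 = 2)" for p
  have star: "star_op {1..n} 1 f p = (real n - 2) * f p" for p
    using star_op_one_point_difference[of "{1..n}" 1 2 3 "\<lambda>k. of_bool (k = 2)" p] n
    by (simp add: f_def[abs_def])
  have "star_op {1..n} 1 (star_op {1..n} 1 f) p = (real n - 2)\<^sup>2 * f p" for p
    using star[of p] star by (simp add: star_op_def power2_eq_square mult.assoc flip: sum_distrib_left)
  then have sum_f: "(\<Sum>t\<in>T2 n. f (p \<circ> t)) = ((real n)\<^sup>2 - 5 * real n + 5) * f p" for p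
    using n by (simp add: sum_T2 power2_eq_square algebra_simps)
  let ?v = "vec (length vs) (\<lambda>i. f (vs ! i))"
  have "id \<in> set vs"
    using vs by (simp add: enumerates_def verts_EAG permutes_id)
  then obtain i where i: "i < length vs" "vs ! i = id"
    by (metis in_set_conv_nth)
  have "?v $ i \<noteq> 0"
    using i by (simp add: f_def)
  then have "?v \<noteq> 0\<^sub>v (length vs)"
    using i(1) by (metis index_zero_vec(1))
  moreover have "adjacency_matrix vs (EAG n) *\<^sub>v ?v = ((real n)\<^sup>2 - 5 * real n + 5) \<cdot>\<^sub>v ?v"
    unfolding adjacency_matrix_EAG_mult_vec[OF vs] by (intro eq_vecI) (simp_all add: sum_f)
  ultimately show ?thesis
    unfolding eigenvalue_def eigenvector_def
    by (intro exI[of _ ?v]) (simp add: adjacency_matrix_def)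
qed

text \<open>With one copy of \<open>a\<close> and one of \<open>b\<close> removed, everything left
  is at most \<open>b\<close>, so the ascending list ends in \<open>b, a\<close>.\<close>

lemma two_largest_of_multiset:
  fixes M :: "'a::linorder multiset"
  assumes "count M a = 1" "b \<in># M" "b < a" "\<And>x. x \<in># M \<Longrightarrow> x \<noteq> a \<Longrightarrow> x \<le> b"
  shows "\<exists>xs. rev (sorted_list_of_multiset M) = a # b # xs"
proof -
  have "a \<in># M"
    using assms(1) by (metis count_inI zero_neq_one)
  then obtain M1 where M1: "M = add_mset a M1"
    by (meson multi_member_split)
  moreover have "b \<in># M1"
    using assms(2,3) M1 by auto
  then obtain M2 where "M1 = add_mset b M2"
    by (meson multi_member_split)
  ultimately have M: "M = add_mset a (add_mset b M2)" by simp
  let ?xs = "sorted_list_of_multiset M2"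
  have "a \<notin># M2"
    using assms(1,3) M by (simp add: not_in_iff split: if_splits)
  then have "\<forall>x\<in>#M2. x \<le> b"
    using assms(4) M by (metis insert_iff set_mset_add_mset_insert)
  then have "sorted (?xs @ [b, a])"
    using assms(3) by (auto simp: sorted_append less_imp_le intro: order_trans)
  moreover have "M = mset (?xs @ [b, a])"
    by (simp add: M)
  ultimately have "sorted_list_of_multiset M = ?xs @ [b, a]"
    by (metis sorted_list_of_multiset_mset sorted_sort_id)
  then show ?thesis by simp
qed

theorem theorem3p2:
  fixes n :: nat
  assumes "n \<ge> 3"
  shows "graph_eigenvalue 1 (EAG n) = (real n - 1) * (real n - 2) \<and>
         graph_eigenvalue 2 (EAG n) = (real n)\<^sup>2 - 5 * real n + 5"
proof -
  let ?l1 = "(real n - 1) * (real n - 2)" and ?l2 = "(real n)\<^sup>2 - 5 * real n + 5"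
  have "finite (verts (EAG n))"
    by (rule finite_subset[OF _ finite_permutations[of "{1..n}"]]) (auto simp: verts_EAG)
  then obtain vs where vs: "enumerates vs (verts (EAG n))"
    using finite_distinct_list by (auto simp: enumerates_def)
  let ?N = "length vs" and ?A = "adjacency_matrix vs (EAG n)"
  have A: "?A \<in> carrier_mat ?N ?N"
    by (simp add: adjacency_matrix_def)
  have "id \<in> set vs"
    using vs by (simp add: enumerates_def verts_EAG permutes_id)
  then have N: "?N > 0"
    by (cases vs) auto
  have lt: "?l2 < ?l1"
    using assms by (simp add: power2_eq_square algebra_simps)
  have row: "(\<Sum>j<?N. ?A $$ (i, j)) = ?l1" if "i < ?N" for i
    using adjacency_matrix_EAG_sum[OF vs that, of "\<lambda>_. 1"] card_T2[of n] assms by simp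
  \<comment> \<open>Since \<open>?l1\<close> exceeds \<open>?l2\<close>, its eigenvectors are
    constant, which gives multiplicity one.\<close>
  have order: "order ?l1 (char_poly ?A) = 1"
  proof (rule order_char_poly_of_simple_ones_eigenvalue[OF A N _ row])
    show "?A $$ (i, j) = ?A $$ (j, i)" if "i < ?N" "j < ?N" for i j
      using that by (simp add: adjacency_matrix_def insert_commute)
  qed (use EAG_large_eigenvalue[OF assms vs _ _ lt] in auto)
  have char: "char_poly ?A \<noteq> 0"
    using degree_monic_char_poly[OF A] by auto
  have root: "x \<in># proots (char_poly ?A) \<longleftrightarrow> eigenvalue ?A x" for x
    using char by (simp add: eigenvalue_root_char_poly[OF A])
  have "\<exists>xs. rev (sorted_list_of_multiset (proots (char_poly ?A))) = ?l1 # ?l2 # xs"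
  proof (rule two_largest_of_multiset[OF _ _ lt])
    show "count (proots (char_poly ?A)) ?l1 = 1"
      using order char by simp
    show "?l2 \<in># proots (char_poly ?A)"
      unfolding root by (rule EAG_second_eigenvalue[OF assms vs])
    fix x assume x: "x \<in># proots (char_poly ?A)" "x \<noteq> ?l1"
    show "x \<le> ?l2"
    \<comment> \<open>An eigenvalue above \<open>?l2\<close> has a constant eigenvector, whose
      eigenvalue is the degree \<open>?l1\<close>.\<close>
    proof (rule ccontr)
      assume "\<not> x \<le> ?l2"
      then have x2: "x > ?l2" by simp
      obtain v where v: "v \<in> carrier_vec ?N" "v \<noteq> 0\<^sub>v ?N" "?A *\<^sub>v v = x \<cdot>\<^sub>v v"
        using x(1) A by (auto simp: root eigenvalue_def eigenvector_def)
      from EAG_large_eigenvalue[OF assms vs v(1,3) x2]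
      obtain a where a: "v = vec ?N (\<lambda>_. a)" by blast
      have "?A *\<^sub>v v = vec ?N (\<lambda>_. ?l1 * a)"
        using adjacency_matrix_EAG_mult_vec[OF vs, of "\<lambda>_. a"] card_T2[of n] assms by (simp add: a)
      then have "?l1 * a = x * a"
        using arg_cong[OF v(3), of "\<lambda>w. w $ 0"] N by (simp add: a)
      then have "a = 0" using x(2) by simp
      with v(2) a show False by auto
    qed
  qed
  then show ?thesis
    unfolding graph_eigenvalue_def graph_eigenvalues_eq[OF vs] by auto
qed

end
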